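(* If $G$ is a word-representable well-partitioned chordal graph, then $\mathcal{R}(G)\le 3$.
   Context: All graphs are finite, simple and connected. A graph $G=(V,E)$ is word-representable if there is a word $w$ over $V$ such that for all distinct $a,b\in V$, $ab\in E$ if and only if $a$ and $b$ alternate in $w$ (the subsequence of $w$ consisting of all occurrences of $a$ and $b$ is of the form $abab\cdots$ or $baba\cdots$). A word is $k$-uniform if every letter occurs exactly $k$ times in it. The representation number $\mathcal{R}(G)$ of a word-representable graph $G$ is the smallest $k$ such that some $k$-uniform word represents $G$. A connected graph $G=(V,E)$ is a well-partitioned chordal graph if there exist a partition $\mathcal{P}$ of $V$ and a tree $\mathcal{T}$ with vertex set $\mathcal{P}$ such that: (1) each part is a clique of $G$; (2) for every edge $AB$ of $\mathcal{T}$ there exist $A'\subseteq A$, $B'\subseteq B$ such that the edges of $G$ between $A$ and $B$ are exactly the pairs in $A'\times B'$; (3) for distinct parts $A,B$ not adjacent in $\mathcal{T}$ there are no edges of $G$ between $A$ and $B$. *)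

theory Defs
  imports "Graph_Theory.Graph_Theory" "HOL-Library.Extended_Nat" "HOL-Library.Disjoint_Sets"
begin

text \<open>
  A finite simple graph is a \<open>pair_graph\<close>: a finite, loop-free, symmetric set of arcs,
  each undirected edge being the two arcs \<open>(a, b)\<close> and \<open>(b, a)\<close>.
\<close>

fun alternating_word :: "'a \<Rightarrow> 'a \<Rightarrow> nat \<Rightarrow> 'a list" where
  "alternating_word a b 0 = []"
| "alternating_word a b (Suc n) = a # alternating_word b a n"

definition alternate_in :: "'a \<Rightarrow> 'a \<Rightarrow> 'a list \<Rightarrow> bool" where
  "alternate_in a b w \<longleftrightarrow>
    (\<exists>n. filter (\<lambda>x. x \<in> {a, b}) w = alternating_word a b n \<or>
         filter (\<lambda>x. x \<in> {a, b}) w = alternating_word b a n)"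

definition represents :: "'a list \<Rightarrow> 'a pair_pre_digraph \<Rightarrow> bool" where
  "represents w G \<longleftrightarrow> w \<in> lists (pverts G) \<and>
    (\<forall>a \<in> pverts G. \<forall>b \<in> pverts G. a \<noteq> b \<longrightarrow>
      ((a, b) \<in> parcs G \<longleftrightarrow> alternate_in a b w))"

definition word_representable :: "'a pair_pre_digraph \<Rightarrow> bool" where
  "word_representable G \<longleftrightarrow> (\<exists>w. represents w G)"

definition uniform_word :: "nat \<Rightarrow> 'a set \<Rightarrow> 'a list \<Rightarrow> bool" where
  "uniform_word k V w \<longleftrightarrow> (\<forall>v \<in> V. count_list w v = k)"

text \<open>
  Only \<open>k \<ge> 1\<close> is admitted: otherwise the empty word would be a 0-uniform word representing
  every complete graph. The value is \<open>\<infinity>\<close> if no uniform word represents the graph.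
\<close>
definition representation_number :: "'a pair_pre_digraph \<Rightarrow> enat" where
  "representation_number G =
    (INF k \<in> {k. k \<ge> 1 \<and> (\<exists>w. uniform_word k (pverts G) w \<and> represents w G)}. enat k)"

text \<open>
  The constant \<open>tree\<close> of the graph library is unsuitable for symmetric arc sets,
  because its notion of cycle includes the closed walk \<open>a, b, a\<close> along a single edge.
\<close>
definition undirected_tree :: "'a pair_pre_digraph \<Rightarrow> bool" where
  "undirected_tree T \<longleftrightarrow> pair_graph T \<and> Digraph_Component.connected (with_proj T) \<and>
    \<not> (\<exists>p. pre_digraph.cycle (with_proj T) p \<and> length p \<ge> 3)"

definition clique :: "'a pair_pre_digraph \<Rightarrow> 'a set \<Rightarrow> bool" where
  "clique G A \<longleftrightarrow> A \<subseteq> pverts G \<and> (\<forall>x \<in> A. \<forall>y \<in> A. x \<noteq> y \<longrightarrow> (x, y) \<in> parcs G)"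

definition well_partitioned_chordal :: "'a pair_pre_digraph \<Rightarrow> bool" where
  "well_partitioned_chordal G \<longleftrightarrow> pair_graph G \<and> Digraph_Component.connected (with_proj G) \<and>
    (\<exists>P T. partition_on (pverts G) P \<and> undirected_tree T \<and> pverts T = P \<and>
      (\<forall>A \<in> P. clique G A) \<and>
      (\<forall>(A, B) \<in> parcs T. \<exists>A' B'. A' \<subseteq> A \<and> B' \<subseteq> B \<and> parcs G \<inter> (A \<times> B) = A' \<times> B') \<and>
      (\<forall>A \<in> P. \<forall>B \<in> P. A \<noteq> B \<and> (A, B) \<notin> parcs T \<longrightarrow> parcs G \<inter> (A \<times> B) = {}))"

end

theory Submission
  imports Defs
begin

text \<open>
  Every edge of the tree cuts \<open>G\<close> along a complete bipartite graph, so \<open>G\<close> is a 1-join of two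
  induced subgraphs, each side keeping one marker vertex of the other side. If \<open>y u\<^sub>1 y u\<^sub>2 y u\<^sub>3\<close> and
  \<open>x v\<^sub>1 x v\<^sub>2 x v\<^sub>3\<close> are 3-uniform words for the two pieces with markers \<open>y\<close> and \<open>x\<close>, then
  \<open>u\<^sub>1 v\<^sub>1 u\<^sub>2 v\<^sub>2 u\<^sub>3 v\<^sub>3\<close> represents the 1-join. Cutting off leaves of the tree one at a time leaves only
  split graphs: a part \<open>K\<close>, which is a clique, with an independent set \<open>I\<close> attached to it.

  For a split graph, number \<open>K\<close> by the order in which a representing word meets its letters.
  Comparing letter counts in prefixes shows that the neighbourhood of \<open>x \<in> I\<close> is either an interval
  \<open>[d, u)\<close> or the complement of an interval \<open>[a, b)\<close>. As the vertices of \<open>I\<close> are pairwise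
  non-adjacent, any two of the intervals \<open>[a, b]\<close> intersect, and \<open>a \<le> d\<close> or \<open>u \<le> b\<close> for vertices of
  different kinds. From these data a 3-uniform word can be written down.
\<close>

section \<open>Alternation and prefix counts\<close>

text \<open>Prefix-count form of alternation with \<open>a\<close> first. Being a pair of pointwise
  inequalities, it can be chained through third letters. For distinct letters, both directions hold
  at once only if neither occurs in \<open>w\<close>.\<close>

definition precedes :: "'a list \<Rightarrow> 'a \<Rightarrow> 'a \<Rightarrow> bool" where
  "precedes w a b \<longleftrightarrow> (\<forall>t. count_list (take t w) b \<le> count_list (take t w) a \<and>
     count_list (take t w) a \<le> Suc (count_list (take t w) b))"

lemma precedes_Nil [simp]: "precedes [] a b"
  by (simp add: precedes_def)

text \<open>A leading \<open>a\<close> shifts the bounds on the two counts by one, which exchanges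
  the roles of the letters.\<close>

lemma precedes_Cons:
  assumes "a \<noteq> b"
  shows "precedes (x # w) a b \<longleftrightarrow>
    (if x = a then precedes w b a else if x = b then False else precedes w a b)"
proof -
  have *: "(\<forall>t. Q t) \<longleftrightarrow> Q 0 \<and> (\<forall>t. Q (Suc t))" for Q :: "nat \<Rightarrow> bool"
    using not0_implies_Suc by metis
  have "\<not> precedes (b # w) a b"
    unfolding precedes_def using assms by (auto intro!: exI[of _ "Suc 0"])
  moreover have "precedes (a # w) a b \<longleftrightarrow> precedes w b a"
    unfolding precedes_def by (subst *) (use assms in auto)
  moreover have "precedes (x # w) a b \<longleftrightarrow> precedes w a b" if "x \<noteq> a" "x \<noteq> b"
    unfolding precedes_def by (subst *) (use assms that in auto)
  ultimately show ?thesis by auto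
qed

text \<open>\<open>alternating_word\<close> swaps its letters at each step just as
  \<open>precedes\<close> does at each \<open>a\<close>; hence the generalisation over both
  letters.\<close>

lemma filter_alternating_iff_precedes:
  "a \<noteq> b \<Longrightarrow> (\<exists>n. filter (\<lambda>x. x \<in> {a, b}) w = alternating_word a b n) \<longleftrightarrow> precedes w a b"
proof (induction w arbitrary: a b)
  case Nil
  have "filter (\<lambda>x. x \<in> {a, b}) [] = alternating_word a b 0" by simp
  then have "\<exists>n. filter (\<lambda>x. x \<in> {a, b}) [] = alternating_word a b n" by (rule exI)
  then show ?case by simp
next
  case (Cons x w)
  have *: "(\<exists>n. Q n) \<longleftrightarrow> Q 0 \<or> (\<exists>n. Q (Suc n))" for Q :: "nat \<Rightarrow> bool"
    using not0_implies_Suc by metis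
  have sw: "filter (\<lambda>x. x \<in> {a, b}) w = filter (\<lambda>x. x \<in> {b, a}) w"
    by (simp add: insert_commute)
  show ?case
  proof (cases "x = a")
    case True
    then show ?thesis
      using Cons.IH[of b a] Cons.prems sw by (subst *) (simp add: precedes_Cons)
  next
    case False
    show ?thesis
    proof (cases "x = b")
      case True
      then show ?thesis using Cons.prems by (subst *) (simp add: precedes_Cons)
    next
      case False
      then show ?thesis using \<open>x \<noteq> a\<close> Cons.IH[OF Cons.prems] Cons.prems
        by (simp add: precedes_Cons)
    qed
  qed
qed

lemma alternate_in_iff_precedes:
  assumes "a \<noteq> b"
  shows "alternate_in a b w \<longleftrightarrow> precedes w a b \<or> precedes w b a"
proof -
  have sw: "filter (\<lambda>x. x \<in> {a, b}) w = filter (\<lambda>x. x \<in> {b, a}) w"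
    by (simp add: insert_commute)
  show ?thesis
    using filter_alternating_iff_precedes[of a b w] filter_alternating_iff_precedes[of b a w] assms sw
    unfolding alternate_in_def by metis
qed

section \<open>3-uniform words and 1-joins\<close>

definition alternate3 :: "'a \<Rightarrow> 'a \<Rightarrow> 'a list \<Rightarrow> bool" where
  "alternate3 a b w \<longleftrightarrow> filter (\<lambda>v. v = a \<or> v = b) w \<in> {[a, b, a, b, a, b], [b, a, b, a, b, a]}"

text \<open>The subgraph of \<open>E\<close> induced on \<open>V\<close> is meant; \<open>E\<close> may relate vertices outside \<open>V\<close> as well.\<close>
definition represents3 :: "('a \<Rightarrow> 'a \<Rightarrow> bool) \<Rightarrow> 'a set \<Rightarrow> 'a list \<Rightarrow> bool" where
  "represents3 E V w \<longleftrightarrow> set w \<subseteq> V \<and> (\<forall>v\<in>V. count_list w v = 3) \<and>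
     (\<forall>a\<in>V. \<forall>b\<in>V. a \<noteq> b \<longrightarrow> (E a b \<longleftrightarrow> alternate3 a b w))"

lemma alternate3_commute: "alternate3 a b w \<longleftrightarrow> alternate3 b a w"
  unfolding alternate3_def by (auto simp: disj_commute)

lemma count_alternating_word:
  "a \<noteq> b \<Longrightarrow> count_list (alternating_word a b n) a = (n + 1) div 2 \<and>
     count_list (alternating_word a b n) b = n div 2"
  by (induction n arbitrary: a b) auto

lemma count_list_filter: "count_list (filter Q xs) x = (if Q x then count_list xs x else 0)"
  by (induction xs) auto

lemma alternate_in_iff_alternate3:
  assumes "a \<noteq> b" "count_list w a = 3" "count_list w b = 3"
  shows "alternate_in a b w \<longleftrightarrow> alternate3 a b w"
proof -
  have cnt: "count_list (filter (\<lambda>x. x \<in> {a, b}) w) c = 3" if "c \<in> {a, b}" for c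
    using that assms by (auto simp: count_list_filter)
  \<comment> \<open>The two counts are \<open>(n + 1) div 2\<close> and \<open>n div 2\<close>, and
    both equal 3.\<close>
  have 6: "n = 6" if "filter (\<lambda>x. x \<in> {a, b}) w = alternating_word c d n" "{c, d} = {a, b}" for c d n
  proof -
    have "c \<noteq> d" "c \<in> {a, b}" "d \<in> {a, b}" using that(2) assms(1) by auto
    then have "(n + 1) div 2 = 3" "n div 2 = 3"
      using count_alternating_word[of c d n] cnt that(1) by metis+
    then show ?thesis by presburger
  qed
  have "alternate_in a b w \<longleftrightarrow> filter (\<lambda>x. x \<in> {a, b}) w = alternating_word a b 6
      \<or> filter (\<lambda>x. x \<in> {a, b}) w = alternating_word b a 6"
    unfolding alternate_in_def using 6[of a b] 6[of b a] by (simp only: insert_commute) blast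
  also have "\<dots> \<longleftrightarrow> alternate3 a b w"
    by (simp add: alternate3_def numeral_eq_Suc)
  finally show ?thesis .
qed

section \<open>Cyclic shifts of 3-uniform words\<close>

lemma alternate3_rotate1:
  assumes "a \<noteq> b"
  shows "alternate3 a b (xs @ [x]) \<longleftrightarrow> alternate3 a b (x # xs)"
  using assms unfolding alternate3_def by (auto simp: snoc_eq_iff_butlast)

text \<open>The two patterns in \<open>alternate3\<close> are cyclic shifts of each other, so
  letters may be moved from the front to the back one at a time.\<close>

lemma represents3_rotate:
  "represents3 E V (xs @ ys) \<Longrightarrow> represents3 E V (ys @ xs)"
proof (induction xs arbitrary: ys)
  case (Cons x xs)
  have "count_list (xs @ ys @ [x]) v = count_list (x # xs @ ys) v" for v by simp
  then have "represents3 E V (xs @ (ys @ [x]))"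
    using Cons.prems alternate3_rotate1[of _ _ "xs @ ys" x]
    unfolding represents3_def by simp
  from Cons.IH[OF this] show ?case by simp
qed simp

lemma represents3_split_marker:
  assumes "represents3 E V w" "y \<in> V"
  obtains u1 u2 u3 where "represents3 E V (y # u1 @ y # u2 @ y # u3)"
    "y \<notin> set u1" "y \<notin> set u2" "y \<notin> set u3"
proof -
  have c: "count_list w y = 3" using assms by (auto simp: represents3_def)
  then have "y \<in> set w" by (metis count_notin zero_neq_numeral)
  then obtain p r where w: "w = p @ y # r" "y \<notin> set p" by (meson split_list_first)
  \<comment> \<open>The part before the first \<open>y\<close> moves to the back; the two other
    occurrences of \<open>y\<close> then cut the rest into three blocks.\<close>
  define v where "v = r @ p"
  have 1: "represents3 E V (y # v)" using represents3_rotate[of E V p "y # r"] assms(1) w v_def by simp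
  have cv: "count_list v y = 2" using c w v_def by simp
  then have "y \<in> set v" by (metis count_notin zero_neq_numeral)
  then obtain u1 r' where v: "v = u1 @ y # r'" "y \<notin> set u1" by (meson split_list_first)
  have cr: "count_list r' y = 1" using cv v by simp
  then have "y \<in> set r'" by (metis count_notin zero_neq_one)
  then obtain u2 u3 where r': "r' = u2 @ y # u3" "y \<notin> set u2" by (meson split_list_first)
  have "count_list u3 y = 0" using cr r' by simp
  then have "y \<notin> set u3" by (simp add: count_list_0_iff)
  then show ?thesis using that 1 v r' by blast
qed

section \<open>Interleaving the blocks of two words\<close>

lemma filter_pair_notin:
  assumes "y \<notin> set xs"
  shows "filter (\<lambda>v. v = x \<or> v = y) xs = replicate (count_list xs x) x"
    "filter (\<lambda>v. v = y \<or> v = x) xs = replicate (count_list xs x) x"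
  using assms by (induction xs) auto

lemma successively_replicate_le_1:
  "successively (\<noteq>) (A @ replicate n x @ B) \<Longrightarrow> n \<le> 1"
proof (rule ccontr)
  assume *: "successively (\<noteq>) (A @ replicate n x @ B)" "\<not> n \<le> 1"
  then obtain k where "n = Suc (Suc k)" by (metis One_nat_def le_SucI le_zero_eq not0_implies_Suc order_refl)
  with *(1) show False by (simp add: successively_append_iff)
qed

text \<open>An alternating word has no equal neighbours, so each of the six blocks has length at
  most 1; the sums 3 then force all lengths to be 1.\<close>

lemma alternate3_interleave:
  assumes "x \<noteq> y" "n1 + n2 + n3 = (3::nat)" "m1 + m2 + m3 = (3::nat)"
    "filter (\<lambda>v. v = x \<or> v = y) w = replicate n1 x @ replicate m1 y @ replicate n2 x @ replicate m2 y
       @ replicate n3 x @ replicate m3 y"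
  shows "alternate3 x y w \<longleftrightarrow> n1 = 1 \<and> n2 = 1 \<and> n3 = 1 \<and> m1 = 1 \<and> m2 = 1 \<and> m3 = 1"
proof
  let ?l = "replicate n1 x @ replicate m1 y @ replicate n2 x @ replicate m2 y
       @ replicate n3 x @ replicate m3 y"
  assume "alternate3 x y w"
  then have "?l \<in> {[x, y, x, y, x, y], [y, x, y, x, y, x]}"
    unfolding alternate3_def assms(4) .
  then have s: "successively (\<noteq>) ?l" using assms(1) by auto
  have "n1 \<le> 1" using successively_replicate_le_1[of "[]" n1 x] s by simp
  moreover have "n2 \<le> 1"
    using successively_replicate_le_1[of "replicate n1 x @ replicate m1 y" n2 x] s by simp
  moreover have "n3 \<le> 1"
    using successively_replicate_le_1[of "replicate n1 x @ replicate m1 y @ replicate n2 x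
      @ replicate m2 y" n3 x] s by simp
  moreover have "m1 \<le> 1" using successively_replicate_le_1[of "replicate n1 x" m1 y] s by simp
  moreover have "m2 \<le> 1"
    using successively_replicate_le_1[of "replicate n1 x @ replicate m1 y @ replicate n2 x" m2 y] s
    by simp
  moreover have "m3 \<le> 1"
    using successively_replicate_le_1[of "replicate n1 x @ replicate m1 y @ replicate n2 x
      @ replicate m2 y @ replicate n3 x" m3 y "[]"] s by simp
  ultimately show "n1 = 1 \<and> n2 = 1 \<and> n3 = 1 \<and> m1 = 1 \<and> m2 = 1 \<and> m3 = 1"
    using assms(2,3) by linarith
next
  assume "n1 = 1 \<and> n2 = 1 \<and> n3 = 1 \<and> m1 = 1 \<and> m2 = 1 \<and> m3 = 1"
  then show "alternate3 x y w" unfolding alternate3_def assms(4) by simp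
qed

text \<open>Alternating with \<open>y\<close> means occurring exactly once in each gap between its
  occurrences. Adjacency to the marker can thus be read off from the blocks after the marker itself
  has been deleted.\<close>

lemma adjacent_marker_iff:
  assumes "represents3 E V (y # u1 @ y # u2 @ y # u3)"
    and "y \<notin> set u1" "y \<notin> set u2" "y \<notin> set u3" "x \<in> V" "y \<in> V" "x \<noteq> y"
  shows "E x y \<longleftrightarrow> count_list u1 x = 1 \<and> count_list u2 x = 1 \<and> count_list u3 x = 1"
    "count_list u1 x + count_list u2 x + count_list u3 x = 3"
proof -
  let ?w = "y # u1 @ y # u2 @ y # u3"
  have c: "count_list ?w x = 3" using assms(1,5) unfolding represents3_def by blast
  then show s: "count_list u1 x + count_list u2 x + count_list u3 x = 3" using assms(7) by simp
  have "filter (\<lambda>v. v = y \<or> v = x) ?w = replicate 1 y @ replicate (count_list u1 x) x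
     @ replicate 1 y @ replicate (count_list u2 x) x @ replicate 1 y @ replicate (count_list u3 x) x"
    using assms(2-4) by (simp add: filter_pair_notin)
  from alternate3_interleave[OF _ _ s this]
  have "alternate3 y x ?w \<longleftrightarrow> count_list u1 x = 1 \<and> count_list u2 x = 1 \<and> count_list u3 x = 1"
    using assms(7) by auto
  moreover have "E x y \<longleftrightarrow> alternate3 x y ?w"
    using assms(1,5,6,7) unfolding represents3_def by blast
  ultimately show "E x y \<longleftrightarrow> count_list u1 x = 1 \<and> count_list u2 x = 1 \<and> count_list u3 x = 1"
    by (simp add: alternate3_commute)
qed

lemma represents3_UnI:
  assumes sym: "\<And>a b. E a b \<Longrightarrow> E b a"
    and inner: "\<And>a b. a \<in> V1 \<Longrightarrow> b \<in> V1 \<Longrightarrow> a \<noteq> b \<Longrightarrow> E a b \<longleftrightarrow> alternate3 a b w"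
      "\<And>a b. a \<in> V2 \<Longrightarrow> b \<in> V2 \<Longrightarrow> a \<noteq> b \<Longrightarrow> E a b \<longleftrightarrow> alternate3 a b w"
    and cross: "\<And>a b. a \<in> V1 \<Longrightarrow> b \<in> V2 \<Longrightarrow> E a b \<longleftrightarrow> alternate3 a b w"
    and "set w \<subseteq> V1 \<union> V2" "\<And>v. v \<in> V1 \<union> V2 \<Longrightarrow> count_list w v = 3"
  shows "represents3 E (V1 \<union> V2) w"
proof -
  have "E a b \<longleftrightarrow> alternate3 a b w" if "a \<in> V2" "b \<in> V1" for a b
    using cross[OF that(2,1)] sym alternate3_commute by metis
  then show ?thesis unfolding represents3_def using assms by blast
qed

text \<open>Two vertices on one side see only their own blocks, in the old order. For a pair across,
  the blocks alternate iff each letter occurs once in each of its blocks, that is, iff each is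
  adjacent to its marker. The markers are vertices of the other side, so a single \<open>E\<close>
  describes all pieces.\<close>

lemma represents3_1_join:
  assumes sym: "\<And>a b. E a b \<Longrightarrow> E b a"
    and "represents3 E (insert y V1) w1" "represents3 E (insert x V2) w2"
    and "V1 \<inter> V2 = {}" "x \<in> V1" "y \<in> V2"
    and cross: "\<And>a b. a \<in> V1 \<Longrightarrow> b \<in> V2 \<Longrightarrow> E a b \<longleftrightarrow> E a y \<and> E b x"
  shows "\<exists>w. represents3 E (V1 \<union> V2) w"
proof -
  obtain u1 u2 u3 where u: "represents3 E (insert y V1) (y # u1 @ y # u2 @ y # u3)"
    "y \<notin> set u1" "y \<notin> set u2" "y \<notin> set u3"
    using represents3_split_marker[OF assms(2)] by blast
  obtain v1 v2 v3 where v: "represents3 E (insert x V2) (x # v1 @ x # v2 @ x # v3)"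
    "x \<notin> set v1" "x \<notin> set v2" "x \<notin> set v3"
    using represents3_split_marker[OF assms(3)] by blast
  let ?w = "u1 @ v1 @ u2 @ v2 @ u3 @ v3"
  have su: "set u1 \<subseteq> V1" "set u2 \<subseteq> V1" "set u3 \<subseteq> V1"
    using u unfolding represents3_def by auto
  have sv: "set v1 \<subseteq> V2" "set v2 \<subseteq> V2" "set v3 \<subseteq> V2"
    using v unfolding represents3_def by auto
  have d1: "a \<notin> set v1 \<and> a \<notin> set v2 \<and> a \<notin> set v3 \<and> a \<noteq> y \<and> y \<noteq> a" if "a \<in> V1" for a
    using that sv assms(4,6) by auto
  have d2: "a \<notin> set u1 \<and> a \<notin> set u2 \<and> a \<notin> set u3 \<and> a \<noteq> x \<and> x \<noteq> a" if "a \<in> V2" for a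
    using that su assms(4,5) by auto
  have m1: "E a y \<longleftrightarrow> count_list u1 a = 1 \<and> count_list u2 a = 1 \<and> count_list u3 a = 1"
    "count_list u1 a + count_list u2 a + count_list u3 a = 3" if "a \<in> V1" for a
    using adjacent_marker_iff[OF u, of a] that d1 by auto
  have m2: "E a x \<longleftrightarrow> count_list v1 a = 1 \<and> count_list v2 a = 1 \<and> count_list v3 a = 1"
    "count_list v1 a + count_list v2 a + count_list v3 a = 3" if "a \<in> V2" for a
    using adjacent_marker_iff[OF v, of a] that d2 by auto
  have "represents3 E (V1 \<union> V2) ?w"
  proof (rule represents3_UnI[OF sym])
    fix a b assume ab: "a \<in> V1" "b \<in> V1" "a \<noteq> b"
    have e: "filter (\<lambda>z. z = a \<or> z = b) v = []" if "v \<in> {v1, v2, v3}" for v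
      using that d1[OF ab(1)] d1[OF ab(2)] by (auto simp: filter_empty_conv)
    have "E a b \<longleftrightarrow> alternate3 a b (y # u1 @ y # u2 @ y # u3)"
      using u(1) ab unfolding represents3_def by blast
    then show "E a b \<longleftrightarrow> alternate3 a b ?w"
      using d1[OF ab(1)] d1[OF ab(2)] by (simp add: alternate3_def e)
  next
    fix a b assume ab: "a \<in> V2" "b \<in> V2" "a \<noteq> b"
    have e: "filter (\<lambda>z. z = a \<or> z = b) v = []" if "v \<in> {u1, u2, u3}" for v
      using that d2[OF ab(1)] d2[OF ab(2)] by (auto simp: filter_empty_conv)
    have "E a b \<longleftrightarrow> alternate3 a b (x # v1 @ x # v2 @ x # v3)"
      using v(1) ab unfolding represents3_def by blast
    then show "E a b \<longleftrightarrow> alternate3 a b ?w"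
      using d2[OF ab(1)] d2[OF ab(2)] by (simp add: alternate3_def e)
  next
    fix a b assume ab: "a \<in> V1" "b \<in> V2"
    have "a \<noteq> b" using ab assms(4) by auto
    have f: "filter (\<lambda>v. v = a \<or> v = b) ?w =
        replicate (count_list u1 a) a @ replicate (count_list v1 b) b @
        replicate (count_list u2 a) a @ replicate (count_list v2 b) b @
        replicate (count_list u3 a) a @ replicate (count_list v3 b) b"
      using d1[OF ab(1)] d2[OF ab(2)] by (simp add: filter_pair_notin)
    have "alternate3 a b ?w \<longleftrightarrow> E a y \<and> E b x"
      unfolding m1(1)[OF ab(1)] m2(1)[OF ab(2)]
        alternate3_interleave[OF \<open>a \<noteq> b\<close> m1(2)[OF ab(1)] m2(2)[OF ab(2)] f] by blast
    then show "E a b \<longleftrightarrow> alternate3 a b ?w" using cross[OF ab] by simp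
  next
    fix a assume "a \<in> V1 \<union> V2"
    then show "count_list ?w a = 3"
      using d1[of a] d2[of a] m1(2)[of a] m2(2)[of a] by auto
  qed (use su sv in auto)
  then show ?thesis by blast
qed

lemma represents3_disjoint:
  assumes sym: "\<And>a b. E a b \<Longrightarrow> E b a"
    and 1: "represents3 E V1 w1" and 2: "represents3 E V2 w2"
    and "V1 \<inter> V2 = {}"
    and cross: "\<And>a b. a \<in> V1 \<Longrightarrow> b \<in> V2 \<Longrightarrow> \<not> E a b"
  shows "represents3 E (V1 \<union> V2) (w1 @ w2)"
proof (rule represents3_UnI[OF sym])
  have d: "set w1 \<inter> V2 = {}" "set w2 \<inter> V1 = {}"
    using 1 2 assms(4) unfolding represents3_def by auto
  {
    fix a b assume ab: "a \<in> V1" "b \<in> V1" "a \<noteq> b"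
    then have "filter (\<lambda>z. z = a \<or> z = b) w2 = []" using d by (auto simp: filter_empty_conv)
    then show "E a b \<longleftrightarrow> alternate3 a b (w1 @ w2)"
      using 1 ab unfolding represents3_def alternate3_def by simp
  next
    fix a b assume ab: "a \<in> V2" "b \<in> V2" "a \<noteq> b"
    then have "filter (\<lambda>z. z = a \<or> z = b) w1 = []" using d by (auto simp: filter_empty_conv)
    then show "E a b \<longleftrightarrow> alternate3 a b (w1 @ w2)"
      using 2 ab unfolding represents3_def alternate3_def by simp
  next
    fix a b assume ab: "a \<in> V1" "b \<in> V2"
    then have "a \<notin> set w2" "b \<notin> set w1" "count_list w1 a = 3" "a \<noteq> b"
      using d 1 assms(4) unfolding represents3_def by auto
    \<comment> \<open>The restriction to the two letters is \<open>aaabbb\<close>.\<close>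
    then have "\<not> alternate3 a b (w1 @ w2)"
      by (simp add: alternate3_def filter_pair_notin numeral_eq_Suc)
    then show "E a b \<longleftrightarrow> alternate3 a b (w1 @ w2)" using cross ab by simp
  next
    fix v assume "v \<in> V1 \<union> V2"
    moreover have "count_list w2 v = 0" if "v \<in> V1" using d that by (auto simp: count_list_0_iff)
    moreover have "count_list w1 v = 0" if "v \<in> V2" using d that by (auto simp: count_list_0_iff)
    ultimately show "count_list (w1 @ w2) v = 3" using 1 2 unfolding represents3_def by auto
  next
    show "set (w1 @ w2) \<subseteq> V1 \<union> V2" using 1 2 unfolding represents3_def by auto
  }
qed

section \<open>Split graphs\<close>

lemma filter_pair_distinct:
  assumes "distinct L" "x \<in> set L" "y \<in> set L" "x \<noteq> y"
  shows "filter (\<lambda>v. v = x \<or> v = y) L \<in> {[x, y], [y, x]}"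
proof -
  let ?F = "filter (\<lambda>v. v = x \<or> v = y) L"
  have s: "set ?F = {x, y}" "distinct ?F" using assms by auto
  then have "length ?F = 2" using assms(4) by (metis card_2_iff distinct_card)
  then obtain p q where pq: "?F = [p, q]"
    by (auto simp: numeral_2_eq_2 length_Suc_conv)
  then have "{p, q} = {x, y}" using s(1) by simp
  then show ?thesis unfolding pq by (auto simp: doubleton_eq_iff)
qed

lemma filter_pair_sort_key:
  assumes "distinct L" "x \<in> set L" "y \<in> set L" "f x < f y"
  shows "filter (\<lambda>v. v = x \<or> v = y) (sort_key f L) = [x, y]"
    "filter (\<lambda>v. v = y \<or> v = x) (sort_key f L) = [x, y]"
proof -
  have "x \<noteq> y" using assms by auto
  from filter_pair_distinct[OF assms(1-3) this]
  show "filter (\<lambda>v. v = x \<or> v = y) (sort_key f L) = [x, y]"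
    using assms(4) by (auto simp: filter_sort)
  then show "filter (\<lambda>v. v = y \<or> v = x) (sort_key f L) = [x, y]" by (simp add: disj_commute)
qed

lemma count_list_distinct: "distinct xs \<Longrightarrow> count_list xs x = (if x \<in> set xs then 1 else 0)"
  by (induction xs) auto

text \<open>
  The word is \<open>S1 Z0 S2 S3\<close>, where \<open>S1\<close> and \<open>S2\<close> run through all vertices and place each vertex of \<open>I\<close>
  just before the letter of \<open>K\<close> with index \<open>a\<close> or \<open>d\<close> (in \<open>S1\<close>), \<open>b\<close> or \<open>u\<close> (in \<open>S2\<close>). \<open>Z0\<close> repeats the vertices with
  interval neighbourhoods in reverse order, and \<open>S3\<close> puts all the others, in reverse order, at the
  index \<open>p\<close> common to the intervals \<open>[a, b]\<close>. The reversals destroy alternation inside \<open>I\<close>. The factor 3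
  in the keys leaves room for breaking ties between vertices of \<open>I\<close> of different kinds at the same index.
\<close>
lemma split_graph_word:
  fixes idx :: "'a \<Rightarrow> nat"
  assumes fin: "finite K" "finite I" and disj: "K \<inter> I = {}"
    and inj: "inj_on idx K"
    and sym: "\<And>a b. E a b \<Longrightarrow> E b a"
    and clique: "\<And>i j. i \<in> K \<Longrightarrow> j \<in> K \<Longrightarrow> i \<noteq> j \<Longrightarrow> E i j"
    and indep: "\<And>x y. x \<in> I \<Longrightarrow> y \<in> I \<Longrightarrow> \<not> E x y"
    and P1: "\<And>x. x \<in> I \<Longrightarrow> P x \<Longrightarrow> a x \<le> p \<and> p \<le> b x"
    and P2: "\<And>x j. x \<in> I \<Longrightarrow> P x \<Longrightarrow> j \<in> K \<Longrightarrow> E x j \<longleftrightarrow> idx j < a x \<or> b x \<le> idx j"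
    and Z1: "\<And>x. x \<in> I \<Longrightarrow> \<not> P x \<Longrightarrow> d x \<le> u x"
    and Z2: "\<And>x j. x \<in> I \<Longrightarrow> \<not> P x \<Longrightarrow> j \<in> K \<Longrightarrow> E x j \<longleftrightarrow> d x \<le> idx j \<and> idx j < u x"
    and PZ: "\<And>x z. x \<in> I \<Longrightarrow> z \<in> I \<Longrightarrow> P x \<Longrightarrow> \<not> P z \<Longrightarrow> a x \<le> d z \<or> u z \<le> b x"
  shows "\<exists>w. represents3 E (K \<union> I) w"
proof -
  obtain L where L: "set L = K \<union> I" "distinct L"
    using finite_distinct_list[of "K \<union> I"] fin by auto
  \<comment> \<open>At equal index a vertex with \<open>P\<close> comes before one without
    \<open>P\<close> in \<open>S1\<close> and after it in \<open>S2\<close>; so equality suffices in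
    both alternatives of \<open>PZ\<close>.\<close>
  define f1 where "f1 v = (if v \<in> K then 3 * idx v + 2 else if P v then 3 * a v else 3 * d v + 1)" for v
  define f2 where "f2 v = (if v \<in> K then 3 * idx v + 2 else if P v then 3 * b v + 1 else 3 * u v)" for v
  define f3 where "f3 v = (if v \<in> K then 2 * idx v + 1 else 2 * p)" for v
  define Z where "Z v \<longleftrightarrow> v \<in> I \<and> \<not> P v" for v
  define S1 where "S1 = sort_key f1 L"
  define Z0 where "Z0 = rev (filter Z S1)"
  define S2 where "S2 = sort_key f2 L"
  define S3 where "S3 = sort_key f3 (rev (filter (\<lambda>v. \<not> Z v) S2))"
  let ?w = "S1 @ Z0 @ S2 @ S3"
  have S1: "set S1 = K \<union> I" "distinct S1" and S2: "set S2 = K \<union> I" "distinct S2"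
    using L by (auto simp: S1_def S2_def)
  have Z0: "set Z0 = {v \<in> K \<union> I. Z v}" "distinct Z0" using S1 by (auto simp: Z0_def)
  have S3: "set S3 = {v \<in> K \<union> I. \<not> Z v}" "distinct S3" using S2 by (auto simp: S3_def)
  \<comment> \<open>Letters with \<open>Z\<close> occur in \<open>S1\<close>, \<open>Z0\<close>,
    \<open>S2\<close>, all others in \<open>S1\<close>, \<open>S2\<close>,
    \<open>S3\<close>.\<close>
  have cnt: "count_list ?w v = 3" if "v \<in> K \<union> I" for v
    using that S1 S2 S3 Z0 by (simp add: count_list_distinct)
  have notZ: "\<not> Z v" if "v \<in> K" for v using that disj by (auto simp: Z_def)
  have one: "filter (\<lambda>v. v = x \<or> v = y) S = [y]" "filter (\<lambda>v. v = y \<or> v = x) S = [y]"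
    if "distinct S" "x \<notin> set S" "y \<in> set S" for x y :: 'a and S
    using that by (simp_all add: filter_pair_notin count_list_distinct)
  have none: "filter (\<lambda>v. v = x \<or> v = y) S = []"
    if "x \<notin> set S" "y \<notin> set S" for x y :: 'a and S
    using that by (auto simp: filter_empty_conv)
  have s1: "filter (\<lambda>v. v = x \<or> v = y) S1 = [x, y]" "filter (\<lambda>v. v = y \<or> v = x) S1 = [x, y]"
    if "x \<in> K \<union> I" "y \<in> K \<union> I" "f1 x < f1 y" for x y
    using filter_pair_sort_key[of L x y f1] that L by (simp_all add: S1_def)
  have s2: "filter (\<lambda>v. v = x \<or> v = y) S2 = [x, y]" "filter (\<lambda>v. v = y \<or> v = x) S2 = [x, y]"
    if "x \<in> K \<union> I" "y \<in> K \<union> I" "f2 x < f2 y" for x y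
    using filter_pair_sort_key[of L x y f2] that L by (simp_all add: S2_def)
  have s3: "filter (\<lambda>v. v = x \<or> v = y) S3 = [x, y]" "filter (\<lambda>v. v = y \<or> v = x) S3 = [x, y]"
    if "x \<in> K \<union> I" "y \<in> K \<union> I" "\<not> Z x" "\<not> Z y" "f3 x < f3 y" for x y
    using filter_pair_sort_key[of "rev (filter (\<lambda>v. \<not> Z v) S2)" x y f3] that S2
    by (simp_all add: S3_def)
  have KK: "alternate3 i j ?w" if "i \<in> K" "j \<in> K" "idx i < idx j" for i j
  proof -
    have "f1 i < f1 j" "f2 i < f2 j" "f3 i < f3 j" using that by (auto simp: f1_def f2_def f3_def)
    moreover have "filter (\<lambda>v. v = i \<or> v = j) Z0 = []"
      using none[of i Z0 j] Z0 notZ that by blast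
    ultimately show ?thesis using that notZ by (simp add: alternate3_def s1 s2 s3)
  qed
  have PK: "E x j \<longleftrightarrow> alternate3 x j ?w" if x: "x \<in> I" "P x" and j: "j \<in> K" for x j
  proof -
    have nx: "\<not> Z x" "x \<notin> K" "x \<noteq> j" using x j disj by (auto simp: Z_def)
    have z: "filter (\<lambda>v. v = x \<or> v = j) Z0 = []"
      using none[of x Z0 j] Z0 notZ nx j by blast
    have i1: "if a x \<le> idx j then f1 x < f1 j else f1 j < f1 x"
      and i2: "if b x \<le> idx j then f2 x < f2 j else f2 j < f2 x"
      and i3: "if p \<le> idx j then f3 x < f3 j else f3 j < f3 x"
      using x j nx by (auto simp: f1_def f2_def f3_def)
    \<comment> \<open>In the outer cases \<open>x\<close> and \<open>j\<close> come in the same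
      order in \<open>S1\<close>, \<open>S2\<close> and \<open>S3\<close>, because \<open>p\<close>
      lies between \<open>a x\<close> and \<open>b x\<close>. In the middle case \<open>x j\<close>
      is followed by \<open>j x\<close>.\<close>
    consider "idx j < a x" | "a x \<le> idx j" "idx j < b x" | "b x \<le> idx j" by linarith
    then show ?thesis
    proof cases
      case 1
      then have "f1 j < f1 x" "f2 j < f2 x" "f3 j < f3 x"
        using i1 i2 i3 P1[OF x] by (auto split: if_splits)
      then show ?thesis using 1 P2[OF x j] x j nx notZ by (simp add: alternate3_def z s1 s2 s3)
    next
      case 2
      then have "f1 x < f1 j" "f2 j < f2 x"
        using i1 i2 by (auto split: if_splits)
      then show ?thesis using 2 P2[OF x j] x j nx by (simp add: alternate3_def z s1 s2)
    next
      case 3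
      then have "f1 x < f1 j" "f2 x < f2 j" "f3 x < f3 j"
        using i1 i2 i3 P1[OF x] by (auto split: if_splits)
      then show ?thesis using 3 P2[OF x j] x j nx notZ by (simp add: alternate3_def z s1 s2 s3)
    qed
  qed
  have ZK: "E x j \<longleftrightarrow> alternate3 x j ?w" if x: "x \<in> I" "\<not> P x" and j: "j \<in> K" for x j
  proof -
    have nx: "Z x" "x \<notin> K" "x \<noteq> j" using x j disj by (auto simp: Z_def)
    have z: "filter (\<lambda>v. v = x \<or> v = j) Z0 = [x]"
      using one(2)[of Z0 j x] Z0 notZ nx j x by auto
    have t: "filter (\<lambda>v. v = x \<or> v = j) S3 = [j]"
      using one(1)[of S3 x j] S3 notZ nx j x by auto
    have i1: "if d x \<le> idx j then f1 x < f1 j else f1 j < f1 x"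
      and i2: "if u x \<le> idx j then f2 x < f2 j else f2 j < f2 x"
      using x j nx by (auto simp: f1_def f2_def)
    \<comment> \<open>\<open>Z0\<close> contributes \<open>x\<close> and \<open>S3\<close>
      contributes \<open>j\<close>. The three cases start with \<open>jxx\<close>, spell
      \<open>xjxjxj\<close>, and spell \<open>xjxxjj\<close>.\<close>
    consider "idx j < d x" | "d x \<le> idx j" "idx j < u x" | "u x \<le> idx j" by linarith
    then show ?thesis
    proof cases
      case 1
      then have "f1 j < f1 x" using i1 by (auto split: if_splits)
      then show ?thesis using 1 Z2[OF x j] x j nx by (simp add: alternate3_def z t s1)
    next
      case 2
      then have "f1 x < f1 j" "f2 j < f2 x" using i1 i2 by (auto split: if_splits)
      then show ?thesis using 2 Z2[OF x j] x j nx by (simp add: alternate3_def z t s1 s2)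
    next
      case 3
      then have "f1 x < f1 j" "f2 x < f2 j" using i1 i2 Z1[OF x] by (auto split: if_splits)
      then show ?thesis using 3 Z2[OF x j] x j nx by (simp add: alternate3_def z t s1 s2)
    qed
  qed
  have ZZ: "\<not> alternate3 x y ?w" if "x \<in> I" "\<not> P x" "y \<in> I" "\<not> P y" "x \<noteq> y" for x y
  proof -
    have "Z x" "Z y" using that by (auto simp: Z_def)
    then have "(\<lambda>v. Z v \<and> (v = x \<or> v = y)) = (\<lambda>v. v = x \<or> v = y)" by auto
    \<comment> \<open>Reversal puts the later of the two letters of \<open>S1\<close> twice in a
      row.\<close>
    then have "filter (\<lambda>v. v = x \<or> v = y) Z0 = rev (filter (\<lambda>v. v = x \<or> v = y) S1)"
      by (simp add: Z0_def rev_filter conj_commute)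
    then show ?thesis
      using filter_pair_distinct[of S1 x y] S1 that by (auto simp: alternate3_def)
  qed
  have PP: "\<not> alternate3 x y ?w" if "x \<in> I" "P x" "y \<in> I" "P y" "x \<noteq> y" for x y
  proof -
    have nz: "\<not> Z x" "\<not> Z y" "x \<notin> K" "y \<notin> K" using that disj by (auto simp: Z_def)
    then have "(\<lambda>v. \<not> Z v \<and> (v = x \<or> v = y)) = (\<lambda>v. v = x \<or> v = y)" by auto
    then have e: "filter (\<lambda>v. v = x \<or> v = y) S3 = sort_key f3 (rev (filter (\<lambda>v. v = x \<or> v = y) S2))"
      by (simp add: S3_def filter_sort rev_filter conj_commute)
    have z: "filter (\<lambda>v. v = x \<or> v = y) Z0 = []"
      using none[of x Z0 y] Z0 nz by blast
    \<comment> \<open>Sorting is stable, so on equal keys \<open>S3\<close> keeps the reversed order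
      of \<open>S2\<close>, and a letter is doubled where the two meet.\<close>
    have "f3 x = f3 y" using nz by (simp add: f3_def)
    then show ?thesis
      using filter_pair_distinct[of S1 x y] filter_pair_distinct[of S2 x y] S1 S2 that
      by (auto simp: alternate3_def e z)
  qed
  have PZ': "\<not> alternate3 x z ?w" if x: "x \<in> I" "P x" and z: "z \<in> I" "\<not> P z" for x z
  proof -
    have nz: "\<not> Z x" "Z z" "x \<notin> K" "z \<notin> K" "x \<noteq> z" using that disj by (auto simp: Z_def)
    have z0: "filter (\<lambda>v. v = x \<or> v = z) Z0 = [z]"
      using one(1)[of Z0 x z] Z0 nz z by auto
    have t: "filter (\<lambda>v. v = x \<or> v = z) S3 = [x]"
      using one(2)[of S3 z x] S3 nz x by auto
    \<comment> \<open>Either \<open>S1 Z0\<close> restricts to \<open>xzz\<close>, or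
      \<open>S1 Z0 S2\<close> restricts to \<open>zxzzx\<close>.\<close>
    show ?thesis
    proof (cases "a x \<le> d z")
      case True
      then have "f1 x < f1 z" using nz x z by (simp add: f1_def)
      then show ?thesis using x z nz by (simp add: alternate3_def z0 t s1)
    next
      case False
      then have "f1 z < f1 x" "f2 z < f2 x" using nz x z PZ[OF x(1) z(1) x(2) z(2)]
        by (auto simp: f1_def f2_def)
      then show ?thesis using x z nz by (simp add: alternate3_def z0 t s1 s2)
    qed
  qed
  have "represents3 E (K \<union> I) ?w"
  proof (rule represents3_UnI[OF sym])
    fix i j assume "i \<in> K" "j \<in> K" "i \<noteq> j"
    moreover from this have "idx i < idx j \<or> idx j < idx i"
      using inj by (meson inj_onD linorder_neqE_nat)
    ultimately show "E i j \<longleftrightarrow> alternate3 i j ?w"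
      using KK[of i j] KK[of j i] clique[of i j] alternate3_commute[of i j] by blast
  next
    fix x y assume "x \<in> I" "y \<in> I" "x \<noteq> y"
    then show "E x y \<longleftrightarrow> alternate3 x y ?w"
      using indep[of x y] ZZ[of x y] PP[of x y] PZ'[of x y] PZ'[of y x] alternate3_commute[of x y]
      by blast
  next
    fix j x assume "j \<in> K" "x \<in> I"
    then show "E j x \<longleftrightarrow> alternate3 j x ?w"
      using PK[of x j] ZK[of x j] sym alternate3_commute[of x j] by blast
  qed (use cnt S1 S2 S3 Z0 in auto)
  then show ?thesis by blast
qed

text \<open>The letters of a clique have pairwise comparable prefix counts, so they form a chain;
  \<open>idx\<close> lists it with larger counts first.\<close>

lemma prefix_count_ranking:
  assumes "finite K"
    and total: "\<And>i j. i \<in> K \<Longrightarrow> j \<in> K \<Longrightarrow> i \<noteq> j \<Longrightarrow> precedes w i j \<or> precedes w j i"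
  obtains idx :: "'a \<Rightarrow> nat" where "inj_on idx K"
    "\<And>i j t. i \<in> K \<Longrightarrow> j \<in> K \<Longrightarrow> idx i \<le> idx j \<Longrightarrow> count_list (take t w) j \<le> count_list (take t w) i"
proof -
  \<comment> \<open>Summing the counts linearises the preorder; letters missing from \<open>w\<close> tie and are separated by \<open>g\<close>.\<close>
  define S where "S i = (\<Sum>t\<le>length w. count_list (take t w) i)" for i
  have R: "count_list (take t w) j \<le> count_list (take t w) i"
    if "i \<in> K" "j \<in> K" "S j \<le> S i" for i j t
  proof (rule ccontr)
    assume "\<not> ?thesis"
    then have less: "count_list (take t w) i < count_list (take t w) j" by simp
    then have "i \<noteq> j" "\<not> precedes w i j" by (auto simp: precedes_def not_le)
    then have "precedes w j i" using total that by blast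
    then have le: "count_list (take s w) i \<le> count_list (take s w) j" for s
      by (simp add: precedes_def)
    \<comment> \<open>Prefixes do not grow beyond \<open>length w\<close>, so the strict inequality
      also occurs at an index of the sum.\<close>
    have "count_list (take (min t (length w)) w) i < count_list (take (min t (length w)) w) j"
      using less by (cases "t \<le> length w") (auto simp: min_def)
    then have "S i < S j" unfolding S_def
      by (intro sum_strict_mono_ex1) (use le in auto)
    then show False using that by simp
  qed
  obtain g :: "'a \<Rightarrow> nat" and n where g: "g ` K = {i. i < n}" "inj_on g K"
    using finite_imp_inj_to_nat_seg[OF assms(1)] by metis
  define B where "B = sum S K"
  have B: "S i \<le> B" if "i \<in> K" for i
    unfolding B_def using that assms(1) by (intro member_le_sum) auto
  \<comment> \<open>Lexicographic order in mixed radix: larger sums first, then \<open>g\<close>,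
    whose values are below \<open>n\<close>. As \<open>B\<close> bounds all sums, the subtraction
    does not truncate.\<close>
  define idx where "idx i = (B - S i) * n + g i" for i
  have gn: "g i < n" if "i \<in> K" for i using g that by auto
  show ?thesis
  proof
    show "inj_on idx K"
    proof (rule inj_onI)
      fix i j assume ij: "i \<in> K" "j \<in> K" "idx i = idx j"
      then have "idx i mod n = idx j mod n" by simp
      then have "g i = g j" using gn ij by (simp add: idx_def)
      then show "i = j" using g ij by (auto dest: inj_onD)
    qed
    fix i j t assume ij: "i \<in> K" "j \<in> K" "idx i \<le> idx j"
    have "S j \<le> S i"
    proof (rule ccontr)
      assume "\<not> S j \<le> S i"
      then have "Suc (B - S j) \<le> B - S i" using B[OF ij(1)] B[OF ij(2)] by linarith
      then have "Suc (B - S j) * n \<le> (B - S i) * n" by (rule mult_le_mono1)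
      then show False using ij gn[OF ij(2)] by (simp add: idx_def)
    qed
    then show "count_list (take t w) j \<le> count_list (take t w) i" using R ij by blast
  qed
qed

text \<open>Adjacency says that one count function dominates the other by at most one, so
  inequalities between counts turn into the interval data of \<open>split_graph_word\<close>. Only
  letters of \<open>K \<union> I\<close> are compared, so a word for a larger graph can be used as
  it stands.\<close>

lemma split_graph_represents3:
  assumes fin: "finite K" "finite I" and disj: "K \<inter> I = {}"
    and sym: "\<And>a b. E a b \<Longrightarrow> E b a"
    and rep: "\<And>x y. x \<in> K \<union> I \<Longrightarrow> y \<in> K \<union> I \<Longrightarrow> x \<noteq> y \<Longrightarrow> E x y \<longleftrightarrow> precedes w x y \<or> precedes w y x"
    and clique: "\<And>i j. i \<in> K \<Longrightarrow> j \<in> K \<Longrightarrow> i \<noteq> j \<Longrightarrow> E i j"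
    and indep: "\<And>x y. x \<in> I \<Longrightarrow> y \<in> I \<Longrightarrow> \<not> E x y"
  shows "\<exists>w. represents3 E (K \<union> I) w"
proof -
  obtain idx :: "'a \<Rightarrow> nat" where inj: "inj_on idx K" and
    idx: "\<And>i j t. i \<in> K \<Longrightarrow> j \<in> K \<Longrightarrow> idx i \<le> idx j \<Longrightarrow> count_list (take t w) j \<le> count_list (take t w) i"
    using prefix_count_ranking[OF fin(1), of w] clique rep by (metis UnI1)
  define c where "c v t = count_list (take t w) v" for v t
  have pre: "precedes w x y \<longleftrightarrow> (\<forall>t. c y t \<le> c x t \<and> c x t \<le> Suc (c y t))" for x y
    by (simp add: precedes_def c_def)
  have mono: "c j t \<le> c i t" if "i \<in> K" "j \<in> K" "idx i \<le> idx j" for i j t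
    using idx that by (simp add: c_def)
  have KK: "c i t \<le> Suc (c j t)" if "i \<in> K" "j \<in> K" for i j t
  proof (cases "i = j")
    case False
    then have "precedes w i j \<or> precedes w j i" using clique rep that by blast
    then show ?thesis unfolding pre using le_SucI by blast
  qed simp
  define In where "In x = {j \<in> K. precedes w j x}" for x
  \<comment> \<open>The second conjunct keeps \<open>Out x\<close> disjoint from
    \<open>In x\<close>; it matters only for letters missing from \<open>w\<close>.\<close>
  define Out where "Out x = {j \<in> K. precedes w x j \<and> \<not> precedes w j x}" for x
  define N where "N x = In x \<union> Out x" for x
  \<comment> \<open>\<open>P x\<close> says that \<open>x\<close> has neighbours on both sides. The
    gap between the last of \<open>In x\<close> and the first of \<open>Out x\<close> is then
    \<open>[a x, b x)\<close>.\<close>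
  define P where "P x \<longleftrightarrow> In x \<noteq> {} \<and> Out x \<noteq> {}" for x
  define a where "a x = Suc (Max (idx ` In x))" for x
  define b where "b x = Min (idx ` Out x)" for x
  \<comment> \<open>A vertex without neighbours gets the empty interval
    \<open>[0, 0)\<close>.\<close>
  define d where "d x = (if N x = {} then 0 else Min (idx ` N x))" for x
  define u where "u x = (if N x = {} then 0 else Suc (Max (idx ` N x)))" for x
  have finIO: "finite (In x)" "finite (Out x)" "finite (N x)" for x
    using fin by (auto simp: In_def Out_def N_def)
  have EN: "E x j \<longleftrightarrow> j \<in> N x" if "x \<in> I" "j \<in> K" for x j
  proof -
    have "x \<noteq> j" using that disj by auto
    then show ?thesis using rep[of x j] that by (auto simp: N_def In_def Out_def)
  qed
  have exIn: "\<exists>i\<in>In x. a x = Suc (idx i)" if "P x" for x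
  proof -
    have "Max (idx ` In x) \<in> idx ` In x" using that finIO by (intro Max_in) (auto simp: P_def)
    then show ?thesis by (auto simp: a_def)
  qed
  have exOut: "\<exists>o'\<in>Out x. b x = idx o'" if "P x" for x
  proof -
    have "Min (idx ` Out x) \<in> idx ` Out x" using that finIO by (intro Min_in) (auto simp: P_def)
    then show ?thesis by (auto simp: b_def)
  qed
  have exN: "\<exists>l\<in>N x. d x = idx l" "\<exists>l\<in>N x. u x = Suc (idx l)" if "N x \<noteq> {}" for x
  proof -
    have "Min (idx ` N x) \<in> idx ` N x" using that finIO by (intro Min_in) auto
    then show "\<exists>l\<in>N x. d x = idx l" using that by (auto simp: d_def)
    have "Max (idx ` N x) \<in> idx ` N x" using that finIO by (intro Max_in) auto
    then show "\<exists>l\<in>N x. u x = Suc (idx l)" using that by (auto simp: u_def)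
  qed
  \<comment> \<open>Otherwise \<open>c o' \<le> c x \<le> c i \<le> c o'\<close> pointwise, so
    \<open>o'\<close> would also precede \<open>x\<close>.\<close>
  have IO: "idx i < idx o'" if "i \<in> In x" "o' \<in> Out x" for i o' x
  proof (rule ccontr)
    assume "\<not> idx i < idx o'"
    then have "c i t \<le> c o' t" for t using mono that by (auto simp: In_def Out_def)
    moreover have "c x t \<le> c i t" "c o' t \<le> c x t" for t using that by (auto simp: In_def Out_def pre)
    ultimately have "c o' t = c x t" for t using le_antisym le_trans by metis
    then have "precedes w o' x" by (simp add: pre)
    then show False using that by (auto simp: Out_def)
  qed
  have ab: "a x \<le> b x" if "P x" for x
    using exIn[OF that] exOut[OF that] IO by fastforce
  \<comment> \<open>Up to the last letter of \<open>In x\<close>,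
    \<open>c x \<le> c i \<le> c j \<le> Suc (c o') \<le> Suc (c x)\<close> puts \<open>j\<close>
    into \<open>In x\<close>. From the first letter of \<open>Out x\<close> on,
    \<open>c j \<le> c o' \<le> c x \<le> c i \<le> Suc (c j)\<close> puts it into
    \<open>Out x\<close>.\<close>
  have PN: "j \<in> N x \<longleftrightarrow> idx j < a x \<or> b x \<le> idx j" if x: "P x" and j: "j \<in> K" for x j
  proof -
    obtain i where i: "i \<in> In x" "a x = Suc (idx i)" using exIn[OF x] by blast
    obtain o' where o: "o' \<in> Out x" "b x = idx o'" using exOut[OF x] by blast
    have i': "i \<in> K" "c x t \<le> c i t" "c i t \<le> Suc (c x t)" for t using i by (auto simp: In_def pre)
    have o': "o' \<in> K" "c o' t \<le> c x t" "c x t \<le> Suc (c o' t)" for t using o by (auto simp: Out_def pre)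
    have "j \<in> In x" if "idx j < a x"
    proof -
      have "c i t \<le> c j t" for t using mono[of j i] that i i' j by simp
      moreover have "c j t \<le> Suc (c o' t)" for t using KK j o' by simp
      ultimately have "precedes w j x" unfolding pre using i'(2) o'(2) le_trans Suc_le_mono by meson
      then show ?thesis using j by (simp add: In_def)
    qed
    moreover have "j \<in> Out x" if "b x \<le> idx j"
    proof -
      have "c j t \<le> c o' t" for t using mono[of o' j] that o o' j by simp
      moreover have "c i t \<le> Suc (c j t)" for t using KK j i' by simp
      ultimately have "precedes w x j" unfolding pre using i'(2) o'(2) le_trans by meson
      moreover have "\<not> precedes w j x"
      proof
        assume "precedes w j x"
        then have "j \<in> In x" using j by (simp add: In_def)
        from IO[OF this o(1)] show False using that o by simp
      qed
      ultimately show ?thesis using j by (simp add: Out_def)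
    qed
    moreover have "idx j < a x" if "j \<in> In x"
      unfolding a_def using that finIO by (simp add: le_imp_less_Suc)
    moreover have "b x \<le> idx j" if "j \<in> Out x"
      unfolding b_def using that finIO by simp
    ultimately show ?thesis by (auto simp: N_def)
  qed
  have ZN: "j \<in> N x \<longleftrightarrow> d x \<le> idx j \<and> idx j < u x" if x: "\<not> P x" and j: "j \<in> K" for x j
  proof
    assume "j \<in> N x"
    then show "d x \<le> idx j \<and> idx j < u x"
      using finIO by (auto simp: d_def u_def le_imp_less_Suc)
  next
    assume *: "d x \<le> idx j \<and> idx j < u x"
    then have "N x \<noteq> {}" by (auto simp: u_def)
    then obtain l m where l: "l \<in> N x" "d x = idx l" and m: "m \<in> N x" "u x = Suc (idx m)"
      using exN by meson
    have lm: "l \<in> K" "m \<in> K" using l m by (auto simp: N_def In_def Out_def)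
    have c: "c m t \<le> c j t" "c j t \<le> c l t" for t
      using mono[of j m] mono[of l j] * l m lm j by auto
    \<comment> \<open>All neighbours are on the same side of \<open>x\<close>, and the counts of
      \<open>j\<close> lie between those of the neighbours \<open>m\<close> and
      \<open>l\<close>.\<close>
    consider "Out x = {}" | "In x = {}" using x by (auto simp: P_def)
    then show "j \<in> N x"
    proof cases
      case 1
      then have "precedes w l x" "precedes w m x" using l m by (auto simp: N_def In_def)
      then have "precedes w j x" unfolding pre using c le_trans by meson
      then show ?thesis using j by (simp add: N_def In_def)
    next
      case 2
      then have "precedes w x l" "precedes w x m" using l m by (auto simp: N_def Out_def)
      then have "precedes w x j" unfolding pre using c le_trans Suc_le_mono by meson
      then show ?thesis using j by (auto simp: N_def Out_def In_def)
    qed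
  qed
  have nonadj: "\<not> precedes w x y" if "x \<in> I" "y \<in> I" "x \<noteq> y" for x y
    using rep[of x y] indep[of x y] that by blast
  have PP: "a y \<le> b x" if x: "x \<in> I" "P x" and y: "y \<in> I" "P y" for x y
  proof (rule ccontr)
    assume *: "\<not> a y \<le> b x"
    then have "x \<noteq> y" using ab[OF x(2)] by auto
    obtain i o1 where i: "i \<in> In x" and o1: "o1 \<in> Out x" "b x = idx o1"
      using exIn[OF x(2)] exOut[OF x(2)] by blast
    obtain i2 o2 where i2: "i2 \<in> In y" "a y = Suc (idx i2)" and o2: "o2 \<in> Out y"
      using exIn[OF y(2)] exOut[OF y(2)] by blast
    have k: "i \<in> K" "o1 \<in> K" "i2 \<in> K" "o2 \<in> K" using i o1 i2 o2 by (auto simp: In_def Out_def)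
    \<comment> \<open>Chain: \<open>c y \<le> c i2 \<le> c o1 \<le> c x \<le> c i \<le> Suc (c o2)
      \<le> Suc (c y)\<close>.\<close>
    have "c y t \<le> c x t \<and> c x t \<le> Suc (c y t)" for t
    proof -
      have "c o1 t \<le> c x t" "c i2 t \<le> c o1 t" "c y t \<le> c i2 t"
        using o1 i2 mono[of o1 i2] k * by (auto simp: In_def Out_def pre)
      moreover have "c x t \<le> c i t" "c i t \<le> Suc (c o2 t)" "c o2 t \<le> c y t"
        using i o2 KK k by (auto simp: In_def Out_def pre)
      ultimately show ?thesis by linarith
    qed
    then show False using nonadj[OF x(1) y(1) \<open>x \<noteq> y\<close>] by (simp add: pre)
  qed
  have PZ: "a x \<le> d z \<or> u z \<le> b x" if x: "x \<in> I" "P x" and z: "z \<in> I" "\<not> P z" for x z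
  proof (rule ccontr)
    assume *: "\<not> ?thesis"
    have "x \<noteq> z" using x z by auto
    have "N z \<noteq> {}" using * by (auto simp: u_def)
    then obtain l m where l: "l \<in> N z" "d z = idx l" and m: "m \<in> N z" "u z = Suc (idx m)"
      using exN by meson
    obtain i where i: "i \<in> In x" "a x = Suc (idx i)" using exIn[OF x(2)] by blast
    obtain o1 where o1: "o1 \<in> Out x" "b x = idx o1" using exOut[OF x(2)] by blast
    have k: "i \<in> K" "o1 \<in> K" "l \<in> K" "m \<in> K" using i o1 l m by (auto simp: In_def Out_def N_def)
    have c: "c i t \<le> c l t" "c m t \<le> c o1 t" "c x t \<le> c i t" "c o1 t \<le> c x t" for t
      using mono[of l i] mono[of o1 m] k i o1 l m * by (auto simp: In_def Out_def pre)
    \<comment> \<open>Now \<open>c m \<le> c o1 \<le> c x \<le> c i \<le> c l\<close>, with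
      \<open>l\<close> and \<open>m\<close> on the same side of \<open>z\<close>; so
      \<open>x\<close> and \<open>z\<close> would alternate.\<close>
    consider "Out z = {}" | "In z = {}" using z by (auto simp: P_def)
    then show False
    proof cases
      case 1
      then have "precedes w l z" "precedes w m z" using l m by (auto simp: N_def In_def)
      then have "precedes w x z" unfolding pre using c le_trans by meson
      then show False using nonadj x z \<open>x \<noteq> z\<close> by blast
    next
      case 2
      then have "precedes w z l" "precedes w z m" using l m by (auto simp: N_def Out_def)
      then have "precedes w z x" unfolding pre using c le_trans Suc_le_mono by meson
      then show False using nonadj x z \<open>x \<noteq> z\<close> by blast
    qed
  qed
  \<comment> \<open>Pairwise intersecting intervals share their largest left end. The
    \<open>0\<close> covers the case that no vertex satisfies \<open>P\<close>.\<close>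
  define p where "p = Max (insert 0 (a ` {x \<in> I. P x}))"
  have p: "a x \<le> p \<and> p \<le> b x" if "x \<in> I" "P x" for x
    unfolding p_def using that fin PP by auto
  have du: "d x \<le> u x" for x
    using exN[of x] ZN[of x] finIO by (cases "N x = {}") (auto simp: d_def u_def le_Suc_eq)
  show ?thesis
    by (rule split_graph_word[where idx = idx and P = P and a = a and b = b and d = d and u = u and p = p])
      (use fin disj inj sym clique indep p PN ZN EN du PZ in auto)
qed

section \<open>Cutting off leaves\<close>

lemma pcas_vwalk_arcs: "pcas u (vwalk_arcs (u # xs)) (last (u # xs))"
  by (induction xs arbitrary: u) auto

lemma pawalk_verts_vwalk_arcs: "pawalk_verts u (vwalk_arcs (u # xs)) = u # xs"
  by (induction xs arbitrary: u) auto

lemma acyclic_ex_low_degree: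
  assumes "pair_graph T" and acyc: "\<not> (\<exists>p. pre_digraph.cycle (with_proj T) p \<and> length p \<ge> 3)"
    and Q: "Q \<subseteq> pverts T" "Q \<noteq> {}"
  shows "\<exists>B\<in>Q. \<forall>A\<in>Q. \<forall>C\<in>Q. (B, A) \<in> parcs T \<longrightarrow> (B, C) \<in> parcs T \<longrightarrow> A = C"
proof (rule ccontr)
  interpret T: pair_graph T by fact
  assume "\<not> ?thesis"
  then have two: "\<exists>A\<in>Q. \<exists>C\<in>Q. (B, A) \<in> parcs T \<and> (B, C) \<in> parcs T \<and> A \<noteq> C" if "B \<in> Q" for B
    using that by blast
  have sym: "(b, a) \<in> parcs T" if "(a, b) \<in> parcs T" for a b
    using T.arcs_symmetric that by blast
  have finQ: "finite Q" using finite_subset[OF Q(1)] T.finite_verts by simp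
  define path where "path xs \<longleftrightarrow> xs \<noteq> [] \<and> distinct xs \<and> set xs \<subseteq> Q \<and> set (vwalk_arcs xs) \<subseteq> parcs T" for xs
  obtain q where q: "q \<in> Q" using Q by blast
  have "path [q]" using q by (simp add: path_def)
  moreover have "length xs < Suc (card Q)" if "path xs" for xs
    using that finQ by (metis card_mono distinct_card le_imp_less_Suc path_def)
  ultimately obtain xs where xs: "path xs" and max: "\<And>ys. path ys \<Longrightarrow> length ys \<le> length xs"
    using ex_has_greatest_nat[of path "[q]" length "Suc (card Q)"] by (meson less_imp_le)
  obtain h r where hr: "xs = h # r" using xs by (cases xs) (auto simp: path_def)
  have h: "h \<in> Q" using xs hr by (simp add: path_def)
  obtain A where A: "A \<in> Q" "(h, A) \<in> parcs T" "r \<noteq> [] \<Longrightarrow> A \<noteq> hd r"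
    using two[OF h] by metis
  have Ah: "A \<noteq> h" using A(2) T.no_loops by fastforce
  have "A \<in> set xs"
  proof (rule ccontr)
    assume "A \<notin> set xs"
    then have "path (A # xs)" using xs hr A sym by (auto simp: path_def)
    then show False using max by fastforce
  qed
  then obtain k r' where r: "r = k # r'" "A \<in> set r'" using A(3) Ah hr by (cases r) auto
  then obtain p1 p2 where p: "r' = p1 @ A # p2" by (meson split_list)
  \<comment> \<open>The initial segment from \<open>h\<close> to \<open>A\<close>; with the arc from
    \<open>A\<close> to \<open>h\<close> it is a cycle, of length at least 3 because
    \<open>k\<close> lies between them.\<close>
  let ?c = "h # k # p1 @ [A]"
  have x: "xs = ?c @ p2" using hr r p by simp
  have ce: "set (vwalk_arcs ?c) \<subseteq> parcs T"
    using xs set_vwalk_arcs_append1[of ?c p2] unfolding x path_def by blast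
  have cas: "pcas A (vwalk_arcs (A # ?c)) A" using pcas_vwalk_arcs[of A ?c] by simp
  have verts: "pawalk_verts A (vwalk_arcs (A # ?c)) = A # ?c" using pawalk_verts_vwalk_arcs[of A ?c] .
  have sub: "set (vwalk_arcs (A # ?c)) \<subseteq> parcs T" using ce sym[OF A(2)] by simp
  have dist: "distinct ?c" using xs x by (simp add: path_def)
  have len: "length (vwalk_arcs (A # ?c)) \<ge> 3"
    using vwalk_length_simp[of "A # ?c"] by (simp only: vwalk_length_def) simp
  have AT: "A \<in> pverts T" using A Q by auto
  have "pre_digraph.cycle (with_proj T) (vwalk_arcs (A # ?c))"
    unfolding pre_digraph.cycle_def pre_digraph.awalk_def
    by (rule exI[of _ A],
      unfold cas_with_proj_eq awalk_verts_with_proj_eq verts with_proj_simps)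
      (use cas sub dist AT in simp)
  then show False using acyc len by blast
qed

text \<open>\<open>Y\<close> collects the markers left behind by the leaves that have already been cut off.\<close>
lemma clique_tree_represents3:
  fixes E :: "'a \<Rightarrow> 'a \<Rightarrow> bool"
  assumes fin: "finite V" "finite \<P>"
    and sym: "\<And>a b. E a b \<Longrightarrow> E b a" and irrefl: "\<And>a. \<not> E a a"
    and rep: "\<And>x y. x \<in> V \<Longrightarrow> y \<in> V \<Longrightarrow> x \<noteq> y \<Longrightarrow> E x y \<longleftrightarrow> precedes w x y \<or> precedes w y x"
    and part: "\<And>A. A \<in> \<P> \<Longrightarrow> A \<subseteq> V" "disjoint \<P>"
    and clique: "\<And>A i j. A \<in> \<P> \<Longrightarrow> i \<in> A \<Longrightarrow> j \<in> A \<Longrightarrow> i \<noteq> j \<Longrightarrow> E i j"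
    and edge: "\<And>A B a b a' b'. A \<in> \<P> \<Longrightarrow> B \<in> \<P> \<Longrightarrow> R A B \<Longrightarrow> a \<in> A \<Longrightarrow> a' \<in> A \<Longrightarrow> b \<in> B \<Longrightarrow> b' \<in> B \<Longrightarrow>
        E a b \<Longrightarrow> E a' b' \<Longrightarrow> E a b'"
    and nonedge: "\<And>A B a b. A \<in> \<P> \<Longrightarrow> B \<in> \<P> \<Longrightarrow> A \<noteq> B \<Longrightarrow> a \<in> A \<Longrightarrow> b \<in> B \<Longrightarrow> E a b \<Longrightarrow> R A B"
    and leaf: "\<And>Q. Q \<subseteq> \<P> \<Longrightarrow> Q \<noteq> {} \<Longrightarrow> \<exists>B\<in>Q. \<forall>A\<in>Q. \<forall>C\<in>Q. R B A \<longrightarrow> R B C \<longrightarrow> A = C"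
    and Q: "Q \<subseteq> \<P>"
    and Y: "Y \<subseteq> V" "Y \<inter> \<Union>Q = {}" "\<And>x y. x \<in> Y \<Longrightarrow> y \<in> Y \<Longrightarrow> \<not> E x y"
      "\<And>y. y \<in> Y \<Longrightarrow> \<exists>C\<in>Q. \<forall>a\<in>\<Union>Q. E y a \<longrightarrow> a \<in> C"
  shows "\<exists>w. represents3 E (\<Union>Q \<union> Y) w"
  using Q Y
proof (induction "card Q" arbitrary: Q Y)
  case 0
  then have "finite Q" using finite_subset[OF _ fin(2)] by blast
  then have "Q = {}" using 0(1) by simp
  with 0 have "Y = {}" by blast
  have "represents3 E {} []" by (simp add: represents3_def)
  then show ?case using \<open>Q = {}\<close> \<open>Y = {}\<close> by auto
next
  case (Suc n)
  note QY = Suc.prems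
  have "Q \<noteq> {}" using Suc.hyps(2) by auto
  then obtain B where B: "B \<in> Q" and uniq: "\<And>A C. A \<in> Q \<Longrightarrow> C \<in> Q \<Longrightarrow> R B A \<Longrightarrow> R B C \<Longrightarrow> A = C"
    using leaf[OF QY(1)] by blast
  define Q' where "Q' = Q - {B}"
  \<comment> \<open>\<open>YB\<close> holds the markers with no neighbour in a part of
    \<open>Q\<close> other than \<open>B\<close>; those in \<open>Y1\<close> are attached to one of
    the remaining parts.\<close>
  define YB where "YB = {y \<in> Y. \<forall>a\<in>\<Union>Q. E y a \<longrightarrow> a \<in> B}"
  define Y1 where "Y1 = Y - YB"
  define V1 where "V1 = \<Union>Q' \<union> Y1"
  define V2 where "V2 = B \<union> YB"
  have BP: "B \<in> \<P>" and QP: "Q' \<subseteq> \<P>" using B QY(1) by (auto simp: Q'_def)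
  have cQ': "n = card Q'" using Suc.hyps(2) B fin QY(1) finite_subset by (fastforce simp: Q'_def)
  have UQ: "\<Union>Q = \<Union>Q' \<union> B" using B by (auto simp: Q'_def)
  have dis: "C \<inter> D = {}" if "C \<in> \<P>" "D \<in> \<P>" "C \<noteq> D" for C D
    using part(2) that by (simp add: disjoint_def)
  have disB: "\<Union>Q' \<inter> B = {}" using dis BP QP by (auto simp: Q'_def)
  have finB: "finite B" "finite YB" using fin part(1)[OF BP] QY(2) finite_subset[of _ V] by (auto simp: YB_def)
  have V12: "\<Union>Q \<union> Y = V1 \<union> V2" by (auto simp: V1_def V2_def Y1_def YB_def UQ)
  have disV: "V1 \<inter> V2 = {}" using disB QY(3) by (auto simp: V1_def V2_def Y1_def YB_def UQ)
  have Y1C: "\<exists>C\<in>Q'. \<forall>a\<in>\<Union>Q. E y a \<longrightarrow> a \<in> C" if "y \<in> Y1" for y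
    using QY(5)[of y] that by (auto simp: Y1_def YB_def Q'_def)
  have Y1B: "\<not> E y b" if "y \<in> Y1" "b \<in> B" for y b
    using Y1C[OF that(1)] that(2) disB UQ by blast
  have YBQ: "\<not> E y a" if "y \<in> YB" "a \<in> \<Union>Q'" for y a
    using that disB UQ by (auto simp: YB_def)
  have YY: "\<not> E x y" if "x \<in> Y" "y \<in> Y" for x y using QY(4) that .
  have subV: "\<Union>Q \<subseteq> V" using part(1) QY(1) by blast
  \<comment> \<open>The piece cut off at \<open>B\<close> is a split graph, and the given
    \<open>w\<close> already represents it in the sense of \<open>precedes\<close>.\<close>
  have split: "\<exists>w. represents3 E (B \<union> I) w"
    if "finite I" "I \<subseteq> V" "B \<inter> I = {}" "\<And>x y. x \<in> I \<Longrightarrow> y \<in> I \<Longrightarrow> \<not> E x y" for I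
  proof (rule split_graph_represents3[OF finB(1) that(1,3) sym, where w = w])
    fix x y assume "x \<in> B \<union> I" "y \<in> B \<union> I" "x \<noteq> y"
    then show "E x y \<longleftrightarrow> precedes w x y \<or> precedes w y x"
      using rep that(2) part(1)[OF BP] by blast
  qed (use clique[OF BP] that(4) in auto)
  show ?case
  proof (cases "\<exists>a\<in>\<Union>Q'. \<exists>b\<in>B. E a b")
    \<comment> \<open>\<open>B\<close> is not joined to the other parts, as happens when it is the
      last one; the two sides are represented separately.\<close>
    case False
    have "\<exists>w. represents3 E (\<Union>Q' \<union> Y1) w"
    proof (rule Suc.hyps(1)[OF cQ' QP])
      show "Y1 \<subseteq> V" "Y1 \<inter> \<Union>Q' = {}" using QY(2,3) by (auto simp: Y1_def UQ)
      show "\<not> E x y" if "x \<in> Y1" "y \<in> Y1" for x y using YY that by (simp add: Y1_def)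
      show "\<exists>C\<in>Q'. \<forall>a\<in>\<Union>Q'. E y a \<longrightarrow> a \<in> C" if "y \<in> Y1" for y
        using Y1C[OF that] UQ by auto
    qed
    then obtain w1 where w1: "represents3 E V1 w1" by (auto simp: V1_def)
    have "\<exists>w. represents3 E (B \<union> YB) w"
    proof (rule split[OF finB(2)])
      show "YB \<subseteq> V" "B \<inter> YB = {}" using QY(2,3) B by (auto simp: YB_def)
      show "\<not> E x y" if "x \<in> YB" "y \<in> YB" for x y using YY that by (simp add: YB_def)
    qed
    then obtain w2 where w2: "represents3 E V2 w2" by (auto simp: V2_def)
    have "\<not> E a b" if ab: "a \<in> V1" "b \<in> V2" for a b
    proof -
      consider "a \<in> \<Union>Q'" "b \<in> B" | "a \<in> \<Union>Q'" "b \<in> YB" | "a \<in> Y1" "b \<in> B" | "a \<in> Y" "b \<in> Y"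
        using ab by (auto simp: V1_def V2_def Y1_def YB_def)
      then show ?thesis
      proof cases
        case 1
        then show ?thesis using False by blast
      next
        case 2
        then show ?thesis using YBQ[of b a] sym by blast
      next
        case 3
        then show ?thesis by (rule Y1B)
      next
        case 4
        then show ?thesis by (rule YY)
      qed
    qed
    from represents3_disjoint[OF sym w1 w2 disV this] show ?thesis unfolding V12 by blast
  next
    case True
    then obtain A x y where A: "A \<in> Q'" and x: "x \<in> A" and y: "y \<in> B" and xy: "E x y" by blast
    have AP: "A \<in> \<P>" "A \<in> Q" "A \<noteq> B" using A QP by (auto simp: Q'_def)
    have xQ: "x \<in> \<Union>Q'" using x A by blast
    have RBA: "R B A" "R A B" using nonedge[OF BP AP(1) _ y x] nonedge[OF AP(1) BP _ x y] AP xy sym by auto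
    \<comment> \<open>\<open>B\<close> has at most one neighbouring part in \<open>Q\<close>, so all
      edges from \<open>B\<close> to other parts end in \<open>A\<close>.\<close>
    have only: "a \<in> A" if ab: "a \<in> \<Union>Q'" "b \<in> B" "E a b" for a b
    proof -
      obtain C where C: "C \<in> Q'" "a \<in> C" using ab by blast
      then have "R B C" using nonedge[OF BP _ _ ab(2) C(2)] ab(3) sym QP by (auto simp: Q'_def)
      then show ?thesis using uniq[of C A] C RBA AP by (auto simp: Q'_def)
    qed
    \<comment> \<open>\<open>y\<close> stays behind as a new marker attached to \<open>A\<close>,
      standing for all of \<open>B\<close>; the induction hypothesis applies.\<close>
    obtain w1 where w1: "represents3 E (insert y V1) w1"
    proof -
      have "\<exists>w. represents3 E (\<Union>Q' \<union> insert y Y1) w"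
      proof (rule Suc.hyps(1)[OF cQ' QP])
        show "insert y Y1 \<subseteq> V" using y part(1)[OF BP] QY(2) by (auto simp: Y1_def)
        show "insert y Y1 \<inter> \<Union>Q' = {}" using y disB QY(3) by (auto simp: Y1_def UQ)
      next
        fix p q assume "p \<in> insert y Y1" "q \<in> insert y Y1"
        moreover have "\<not> E q y \<and> \<not> E y q" if "q \<in> Y1" for q
          using Y1B[OF that y] sym by blast
        ultimately show "\<not> E p q" using irrefl YY by (auto simp: Y1_def)
      next
        fix p assume "p \<in> insert y Y1"
        moreover have "\<forall>a\<in>\<Union>Q'. E y a \<longrightarrow> a \<in> A" using only[OF _ y] sym by blast
        ultimately show "\<exists>C\<in>Q'. \<forall>a\<in>\<Union>Q'. E p a \<longrightarrow> a \<in> C"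
          using A Y1C[of p] unfolding UQ by blast
      qed
      then show ?thesis using that by (auto simp: V1_def)
    qed
    \<comment> \<open>On the leaf side \<open>x\<close> joins the independent set, so this piece is
      again a split graph.\<close>
    obtain w2 where w2: "represents3 E (insert x V2) w2"
    proof -
      have "\<exists>w. represents3 E (B \<union> insert x YB) w"
      proof (rule split)
        show "finite (insert x YB)" using finB by simp
        show "insert x YB \<subseteq> V" using xQ subV UQ QY(2) by (auto simp: YB_def)
        show "B \<inter> insert x YB = {}" using xQ disB QY(3) UQ by (auto simp: YB_def)
      next
        fix p q assume "p \<in> insert x YB" "q \<in> insert x YB"
        moreover have "\<not> E q x \<and> \<not> E x q" if "q \<in> YB" for q
          using YBQ[OF that xQ] sym by blast
        ultimately show "\<not> E p q" using irrefl YY by (auto simp: YB_def)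
      qed
      then show ?thesis using that by (auto simp: V2_def)
    qed
    \<comment> \<open>Between \<open>A\<close> and \<open>B\<close> the exchange property
      \<open>edge\<close>, applied with the edge \<open>x y\<close>, gives both directions. Vertices
      of \<open>Y1\<close> and \<open>YB\<close> have no edges across, nor to the marker
      opposite.\<close>
    have cross: "E a b \<longleftrightarrow> E a y \<and> E b x" if ab: "a \<in> V1" "b \<in> V2" for a b
    proof -
      consider "a \<in> \<Union>Q'" "b \<in> B" | "a \<in> \<Union>Q'" "b \<in> YB" | "a \<in> Y1"
        using ab by (auto simp: V1_def V2_def)
      then show ?thesis
      proof cases
        case 1
        show ?thesis
        proof
          assume "E a b"
          then have "a \<in> A" using only 1 by blast
          then show "E a y \<and> E b x"
            using edge[OF AP(1) BP RBA(2) _ x 1(2) y \<open>E a b\<close> xy]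
              edge[OF AP(1) BP RBA(2) x _ y 1(2) xy \<open>E a b\<close>] sym by blast
        next
          assume "E a y \<and> E b x"
          moreover from this have "a \<in> A" using only 1 y by blast
          ultimately show "E a b"
            using edge[OF AP(1) BP RBA(2) _ x y 1(2), of a] sym by blast
        qed
      next
        case 2
        then show ?thesis using YBQ[of b a] YBQ[of b x] xQ sym by blast
      next
        case 3
        then have "\<not> E a y" using Y1B y by blast
        moreover have "\<not> E a b"
        proof (cases "b \<in> B")
          case True
          then show ?thesis using Y1B 3 by blast
        next
          case False
          then have "a \<in> Y" "b \<in> Y" using ab 3 by (auto simp: V2_def Y1_def YB_def)
          then show ?thesis by (rule YY)
        qed
        ultimately show ?thesis by blast
      qed
    qed
    have "x \<in> V1" "y \<in> V2" using xQ y by (auto simp: V1_def V2_def)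
    from represents3_1_join[OF sym w1 w2 disV this cross] show ?thesis unfolding V12 by blast
  qed
qed

theorem theorem3:
  fixes G :: "'a pair_pre_digraph"
  assumes "pair_graph G"
    and "Digraph_Component.connected (with_proj G)"
    and "word_representable G"
    and "well_partitioned_chordal G"
  shows "representation_number G \<le> 3"
proof -
  interpret G: pair_graph G by fact
  define E where "E a b \<longleftrightarrow> (a, b) \<in> parcs G" for a b
  obtain P T where PT: "partition_on (pverts G) P \<and> undirected_tree T \<and> pverts T = P \<and>
      (\<forall>A \<in> P. clique G A) \<and>
      (\<forall>(A, B) \<in> parcs T. \<exists>A' B'. A' \<subseteq> A \<and> B' \<subseteq> B \<and> parcs G \<inter> (A \<times> B) = A' \<times> B') \<and>
      (\<forall>A \<in> P. \<forall>B \<in> P. A \<noteq> B \<and> (A, B) \<notin> parcs T \<longrightarrow> parcs G \<inter> (A \<times> B) = {})"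
    using assms(4) unfolding well_partitioned_chordal_def by (elim conjE exE) (rule that, simp)
  then have part: "partition_on (pverts G) P" and T: "undirected_tree T" "pverts T = P"
    and cl: "\<And>A. A \<in> P \<Longrightarrow> clique G A" by auto
  have edge: "\<exists>A' B'. A' \<subseteq> A \<and> B' \<subseteq> B \<and> parcs G \<inter> (A \<times> B) = A' \<times> B'"
    if "(A, B) \<in> parcs T" for A B
    using PT that by fast
  have nonedge: "parcs G \<inter> (A \<times> B) = {}"
    if "A \<in> P" "B \<in> P" "A \<noteq> B" "(A, B) \<notin> parcs T" for A B
    using PT that by simp
  obtain w where w: "represents w G" using assms(3) by (auto simp: word_representable_def)
  have pgT: "pair_graph T" and acyc: "\<not> (\<exists>p. pre_digraph.cycle (with_proj T) p \<and> length p \<ge> 3)"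
    using T by (auto simp: undirected_tree_def)
  have finV: "finite (pverts G)" using G.finite_verts by simp
  have "\<exists>w. represents3 E (\<Union>P \<union> {}) w"
  proof (rule clique_tree_represents3[where R = "\<lambda>A B. (A, B) \<in> parcs T" and \<P> = P and w = w and V = "pverts G"])
    show "finite (pverts G)" by fact
    show "finite P" using finV part by (meson finite_elements)
    show "E b a" if "E a b" for a b using that G.arcs_symmetric unfolding E_def by blast
    show "\<not> E a a" for a using G.no_loops unfolding E_def by fastforce
    show "E x y \<longleftrightarrow> precedes w x y \<or> precedes w y x"
      if "x \<in> pverts G" "y \<in> pverts G" "x \<noteq> y" for x y
      using w that alternate_in_iff_precedes[OF that(3)] unfolding represents_def E_def by blast
    show "A \<subseteq> pverts G" if "A \<in> P" for A using that part by (auto simp: partition_on_def)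
    show "disjoint P" using part by (simp add: partition_on_def)
    show "E i j" if "A \<in> P" "i \<in> A" "j \<in> A" "i \<noteq> j" for A i j
      using cl that unfolding clique_def E_def by blast
    \<comment> \<open>The product form \<open>A' \<times> B'\<close> enters only as this exchange of
      endpoints.\<close>
    show "E a b'" if "(A, B) \<in> parcs T" "a \<in> A" "a' \<in> A" "b \<in> B" "b' \<in> B" "E a b" "E a' b'"
      for A B a b a' b'
      using edge[OF that(1)] that(2-) unfolding E_def by blast
    show "(A, B) \<in> parcs T" if "A \<in> P" "B \<in> P" "A \<noteq> B" "a \<in> A" "b \<in> B" "E a b" for A B a b
      using nonedge that unfolding E_def by blast
    show "\<exists>B\<in>Q. \<forall>A\<in>Q. \<forall>C\<in>Q. (B, A) \<in> parcs T \<longrightarrow> (B, C) \<in> parcs T \<longrightarrow> A = C"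
      if "Q \<subseteq> P" "Q \<noteq> {}" for Q
      using acyclic_ex_low_degree[OF pgT acyc] that T by blast
  qed auto
  then obtain v where v: "represents3 E (pverts G) v" using part by (auto simp: partition_on_def)
  then have "uniform_word 3 (pverts G) v" by (simp add: represents3_def uniform_word_def)
  moreover have "represents v G"
    using v alternate_in_iff_alternate3 unfolding represents3_def represents_def E_def
    by (metis in_listsI subsetD)
  ultimately have "3 \<in> {k. k \<ge> 1 \<and> (\<exists>w. uniform_word k (pverts G) w \<and> represents w G)}" by auto
  then have "representation_number G \<le> enat 3"
    unfolding representation_number_def by (rule INF_lower)
  then show ?thesis by (simp add: numeral_eq_enat)
qed

end
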